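(* For every graph $G$ and every 2-switch $\tau$ on $G$, $|\pi(\tau(G))-\pi(G)|\le 1$, where $\pi$ denotes the path-covering number.
   Context: Graphs are finite and simple. A 2-switch on $G$ is specified by four distinct vertices $a,b,c,d$ with $ab,cd\in E(G)$ and $ac,bd\notin E(G)$; it produces $\tau(G)=G-ab-cd+ac+bd$. A path covering of $G$ is a set of pairwise vertex-disjoint paths in $G$ (single vertices allowed) covering all vertices of $G$; $\pi(G)$ is the minimum number of paths in a path covering of $G$. *)

theory Defs
  imports "Graph_Theory.Graph_Theory"
begin

text \<open>
  Finite simple graphs are \<^term>\<open>pair_graph\<close>s: an undirected edge $uv$ is the pair of arcs
  \<^term>\<open>(u, v)\<close> and \<^term>\<open>(v, u)\<close>.
\<close>

definition is_two_switch :: "'a pair_pre_digraph \<Rightarrow> 'a \<Rightarrow> 'a \<Rightarrow> 'a \<Rightarrow> 'a \<Rightarrow> bool" where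
  "is_two_switch G a b c d \<longleftrightarrow>
     distinct [a, b, c, d] \<and>
     (a, b) \<in> parcs G \<and> (c, d) \<in> parcs G \<and> (a, c) \<notin> parcs G \<and> (b, d) \<notin> parcs G"

definition two_switch :: "'a pair_pre_digraph \<Rightarrow> 'a \<Rightarrow> 'a \<Rightarrow> 'a \<Rightarrow> 'a \<Rightarrow> 'a pair_pre_digraph" where
  "two_switch G a b c d =
     \<lparr> pverts = pverts G,
       parcs = (parcs G - {(a, b), (b, a), (c, d), (d, c)}) \<union> {(a, c), (c, a), (b, d), (d, b)} \<rparr>"

text \<open>
  A path is represented by the list of its vertices. A list and its reverse describe the same
  undirected path; disjointness prevents both from occurring in one covering, so the cardinality
  below counts undirected paths.
\<close>

definition path_covering :: "'a pair_pre_digraph \<Rightarrow> 'a vwalk set \<Rightarrow> bool" where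
  "path_covering G P \<longleftrightarrow>
     (\<forall>p\<in>P. vpath p (with_proj G)) \<and>
     (\<forall>p\<in>P. \<forall>q\<in>P. p \<noteq> q \<longrightarrow> set p \<inter> set q = {}) \<and>
     (\<Union>p\<in>P. set p) = pverts G"

definition path_covering_number :: "'a pair_pre_digraph \<Rightarrow> nat" where
  "path_covering_number G = (LEAST k. \<exists>P. path_covering G P \<and> card P = k)"

lemma pair_graph_two_switch:
  assumes "pair_graph G" and "is_two_switch G a b c d"
  shows "pair_graph (two_switch G a b c d)"
proof -
  interpret pair_graph G by fact
  have s: "sym (parcs G)"
    using pair_sym_arcs by (simp add: symmetric_def)
  have v: "a \<in> pverts G" "b \<in> pverts G" "c \<in> pverts G" "d \<in> pverts G"
    using assms(2) by (auto simp: is_two_switch_def dest: in_arcsD1 in_arcsD2)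
  have "sym (parcs (two_switch G a b c d))"
    using s by (auto simp: two_switch_def sym_def)
  then show ?thesis
    using v assms(2)
    by unfold_locales
      (auto simp: two_switch_def is_two_switch_def symmetric_def
        dest: in_arcsD1 in_arcsD2 pair_no_loops)
qed

lemma finite_path_covering:
  assumes "finite (pverts G)" and "path_covering G P"
  shows "finite P"
proof (rule finite_subset)
  show "P \<subseteq> {p. set p \<subseteq> pverts G \<and> distinct p}"
    using assms(2) by (auto simp: path_covering_def vpath_def)
  show "finite {p. set p \<subseteq> pverts G \<and> distinct p}"
    using assms(1) by (rule finite_subset_distinct)
qed

lemma path_covering_singletons:
  "path_covering G ((\<lambda>v. [v]) ` pverts G)"
  by (auto simp: path_covering_def vpath_def vwalk_def)

end

theory Submission
  imports Defs
begin

text \<open>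
  A minimum path covering of $G$ becomes a path covering of $G - ab - cd$ after cutting its paths
  at $ab$ and $cd$. At most one cut costs at most one path. If both cuts occur, then $a,b,c,d$ are
  ends of paths of the resulting covering, and adding back $ac$ or $bd$ merges two of these unless
  $a,c$ lie on one path and $b,d$ on one path. That is impossible: the first cut separates $a$ from
  $b$, so it would also separate $c$ from $d$, which were still adjacent on a path. The converse
  inequality holds because $G$ arises from $\tau(G)$ by the 2-switch given by $a,c,b,d$.
\<close>

definition path_ends :: "'a vwalk set \<Rightarrow> 'a set" where
  "path_ends P = hd ` P \<union> last ` P"

definition delete_edge :: "'a pair_pre_digraph \<Rightarrow> 'a \<Rightarrow> 'a \<Rightarrow> 'a pair_pre_digraph" where
  "delete_edge G u v = \<lparr> pverts = pverts G, parcs = parcs G - {(u, v), (v, u)} \<rparr>"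

lemma delete_edge_simps [simp]:
  "pverts (delete_edge G u v) = pverts G"
  "parcs (delete_edge G u v) = parcs G - {(u, v), (v, u)}"
  by (simp_all add: delete_edge_def)

text \<open>The arcs of the graph enter only through one inclusion here, so deleting edges,
  splitting a list or concatenating two lists reduces to facts about
  \<open>vwalk_arcs\<close>.\<close>

lemma vpath_with_proj_iff:
  "vpath p (with_proj G) \<longleftrightarrow>
     p \<noteq> [] \<and> distinct p \<and> set p \<subseteq> pverts G \<and> set (vwalk_arcs p) \<subseteq> parcs G"
  by (auto simp: vpath_def vwalk_def)

lemma vpath_rev:
  assumes "sym (parcs G)" and "vpath p (with_proj G)"
  shows "vpath (rev p) (with_proj G)"
  using assms by (auto simp: vpath_with_proj_iff set_vwalk_arcs_rev dest: symD)

lemma path_covering_mono: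
  assumes "path_covering G P" and "pverts H = pverts G" and "parcs G \<subseteq> parcs H"
  shows "path_covering H P"
  using assms by (fastforce simp: path_covering_def vpath_with_proj_iff)

lemma in_vwalk_arcs_split:
  assumes "(u, v) \<in> set (vwalk_arcs p)"
  obtains q r where "p = q @ r" "q \<noteq> []" "r \<noteq> []" "last q = u" "hd r = v"
proof -
  have "\<exists>q r. p = q @ r \<and> q \<noteq> [] \<and> r \<noteq> [] \<and> last q = u \<and> hd r = v"
    using assms
  proof (induction p rule: vwalk_arcs.induct)
    case (3 x y xs)
    show ?case
    proof (cases "(u, v) = (x, y)")
      case True
      then have "x # y # xs = [u] @ (y # xs) \<and> last [u] = u \<and> hd (y # xs) = v" by simp
      then show ?thesis by blast
    next
      case False
      with 3 obtain q r where "y # xs = q @ r" "q \<noteq> []" "r \<noteq> []" "last q = u" "hd r = v"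
        by auto
      then have "x # y # xs = (x # q) @ r \<and> x # q \<noteq> [] \<and> r \<noteq> [] \<and> last (x # q) = u \<and> hd r = v"
        by simp
      then show ?thesis by blast
    qed
  qed auto
  then show thesis using that by blast
qed

text \<open>Disjointness lets at most one path use the edge \<open>uv\<close>. The cut case records
  more than the new size because a second cut follows: old ends persist, each new path lies inside
  an old one, and \<open>u\<close>, \<open>v\<close> are separated.\<close>

lemma path_covering_delete_edge_cases:
  assumes G: "finite (pverts G)" and P: "path_covering G P"
  obtains
    (unused) "path_covering (delete_edge G u v) P"
  | (cut) p Q where "path_covering (delete_edge G u v) Q" "card Q = card P + 1"
      "p \<in> P" "u \<in> set p" "v \<in> set p"
      "path_ends P \<union> {u, v} \<subseteq> path_ends Q"
      "\<forall>q\<in>Q. \<exists>p\<in>P. set q \<subseteq> set p"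
      "\<forall>q\<in>Q. \<not> {u, v} \<subseteq> set q"
proof (cases "\<exists>p\<in>P. (u, v) \<in> set (vwalk_arcs p) \<or> (v, u) \<in> set (vwalk_arcs p)")
  case False
  then have "path_covering (delete_edge G u v) P"
    using P by (auto simp: path_covering_def vpath_with_proj_iff)
  then show thesis by (rule unused)
next
  case True
  have "finite P" using assms by (rule finite_path_covering)
  from True obtain p where p: "p \<in> P"
    and uses: "(u, v) \<in> set (vwalk_arcs p) \<or> (v, u) \<in> set (vwalk_arcs p)" by blast
  \<comment> \<open>An equality of sets covers both directions in which \<open>p\<close> may
    traverse the edge.\<close>
  from uses obtain q r where qr: "p = q @ r" "q \<noteq> []" "r \<noteq> []" and ends: "{last q, hd r} = {u, v}"
  proof (elim disjE in_vwalk_arcs_split, goal_cases)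
    case (1 q r)
    then show ?case by (intro 1(1)[of q r]) auto
  next
    case (2 q r)
    then show ?case by (intro 2(1)[of q r]) auto
  qed
  have path: "vpath s (with_proj G)" if "s \<in> P" for s
    using P that by (auto simp: path_covering_def)
  have disj: "set s \<inter> set t = {}" if "s \<in> P" "t \<in> P" "s \<noteq> t" for s t
    using P that by (auto simp: path_covering_def)
  have qr_disj: "set q \<inter> set r = {}" using path[OF p] qr by (auto simp: vpath_with_proj_iff)
  have last_q: "last q \<in> set q" and hd_r: "hd r \<in> set r" using qr by auto
  have set_p: "set p = set q \<union> set r" using qr by simp
  have away: "set s \<inter> set q = {}" "set s \<inter> set r = {}" if "s \<in> P - {p}" for s
    using disj[of s p] that p unfolding set_p by blast+
  define Q where "Q = insert q (insert r (P - {p}))"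
  \<comment> \<open>Each piece contains a vertex outside all other members of \<open>Q\<close>, so
    replacing \<open>p\<close> by the two pieces raises the cardinality by exactly one.\<close>
  have notin: "q \<notin> P - {p}" "r \<notin> P - {p}" "q \<noteq> r"
    using away qr_disj last_q hd_r by blast+
  have sep: "\<not> {u, v} \<subseteq> set s" if "s \<in> Q" for s
    using that away[of s] qr_disj last_q hd_r unfolding ends[symmetric] Q_def by blast
  have Qpath: "vpath s (with_proj G)" if "s \<in> Q" for s
    using that path path[OF p] qr
    by (auto simp: Q_def vpath_with_proj_iff vwalk_arcs_append)
  \<comment> \<open>A path using the deleted edge would contain both of its ends, contrary to
    \<open>sep\<close>.\<close>
  have "vpath s (with_proj (delete_edge G u v))" if "s \<in> Q" for s
  proof -
    have "(x, y) \<in> set (vwalk_arcs s) \<Longrightarrow> {x, y} \<subseteq> set s" for x y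
      by (auto elim: in_set_vwalk_arcsE)
    then have "(u, v) \<notin> set (vwalk_arcs s)" "(v, u) \<notin> set (vwalk_arcs s)"
      using sep[OF that] by blast+
    then show ?thesis using Qpath[OF that] by (auto simp: vpath_with_proj_iff)
  qed
  moreover have "set s \<inter> set t = {}" if "s \<in> Q" "t \<in> Q" "s \<noteq> t" for s t
    using that disj away qr_disj unfolding Q_def by blast
  moreover have "(\<Union>s\<in>Q. set s) = pverts G"
  proof -
    have "(\<Union>s\<in>Q. set s) = (\<Union>s\<in>P. set s)"
      using p set_p unfolding Q_def by blast
    then show ?thesis using P by (simp add: path_covering_def)
  qed
  ultimately have "path_covering (delete_edge G u v) Q"
    by (simp add: path_covering_def)
  moreover have "card Q = card P + 1"
  proof -
    have "card (P - {p}) = card P - 1" "card P > 0"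
      using p \<open>finite P\<close> by (auto simp: card_gt_0_iff)
    then show ?thesis using notin \<open>finite P\<close> by (simp add: Q_def)
  qed
  moreover have "{u, v} \<subseteq> set p"
    using last_q hd_r unfolding ends[symmetric] set_p by blast
  moreover have "path_ends P \<union> {u, v} \<subseteq> path_ends Q"
  proof -
    have "hd p = hd q" "last p = last r" using qr by auto
    then have "path_ends P \<subseteq> path_ends Q" by (auto simp: path_ends_def Q_def)
    moreover have "{u, v} \<subseteq> path_ends Q"
      unfolding ends[symmetric] by (auto simp: path_ends_def Q_def)
    ultimately show ?thesis by simp
  qed
  moreover have "\<forall>s\<in>Q. \<exists>t\<in>P. set s \<subseteq> set t" using p set_p unfolding Q_def by blast
  ultimately show thesis using cut[of Q p] p sep by simp
qed

lemma path_covering_join: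
  assumes sym: "sym (parcs G)" and fin: "finite (pverts G)" and P: "path_covering G P"
    and p: "p \<in> P" and q: "q \<in> P" and "p \<noteq> q"
    and x: "x = hd p \<or> x = last p" and y: "y = hd q \<or> y = last q" and xy: "(x, y) \<in> parcs G"
  obtains Q where "path_covering G Q" "card Q + 1 = card P"
proof -
  have "finite P" using fin P by (rule finite_path_covering)
  have path: "vpath s (with_proj G)" if "s \<in> P" for s
    using P that by (auto simp: path_covering_def)
  have disj: "set s \<inter> set t = {}" if "s \<in> P" "t \<in> P" "s \<noteq> t" for s t
    using P that by (auto simp: path_covering_def)
  have ne: "p \<noteq> []" "q \<noteq> []" using path[OF p] path[OF q] by (auto simp: vpath_with_proj_iff)
  \<comment> \<open>Reversing where necessary makes \<open>x\<close> the last vertex of one list and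
    \<open>y\<close> the first of the other, so that concatenation inserts exactly the arc from
    \<open>x\<close> to \<open>y\<close>.\<close>
  obtain p' where p': "vpath p' (with_proj G)" "set p' = set p" "last p' = x"
    using path[OF p] vpath_rev[OF sym path[OF p]] x ne by (metis last_rev set_rev)
  obtain q' where q': "vpath q' (with_proj G)" "set q' = set q" "hd q' = y"
    using path[OF q] vpath_rev[OF sym path[OF q]] y ne by (metis hd_rev set_rev)
  define Q where "Q = insert (p' @ q') (P - {p, q})"
  have join: "vpath (p' @ q') (with_proj G)"
    using p' q' disj[OF p q \<open>p \<noteq> q\<close>] xy by (auto simp: vpath_with_proj_iff vwalk_arcs_append)
  have union: "set (p' @ q') = set p \<union> set q" using p' q' by simp
  have away: "set (p' @ q') \<inter> set s = {}" if "s \<in> P - {p, q}" for s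
    using that disj p q unfolding union by blast
  have "\<forall>s\<in>Q. vpath s (with_proj G)" using join path by (auto simp: Q_def)
  moreover have "set s \<inter> set t = {}" if "s \<in> Q" "t \<in> Q" "s \<noteq> t" for s t
    using that disj away unfolding Q_def by blast
  moreover have "(\<Union>s\<in>Q. set s) = pverts G"
  proof -
    have "(\<Union>s\<in>Q. set s) = (\<Union>s\<in>P. set s)"
      using p q union unfolding Q_def by blast
    then show ?thesis using P by (simp add: path_covering_def)
  qed
  ultimately have "path_covering G Q" by (simp add: path_covering_def)
  moreover have "card Q + 1 = card P"
  proof -
    have "p' @ q' \<notin> P - {p, q}" using away ne union by fastforce
    moreover have "card P = card (P - {p, q}) + card {p, q}"
      using p q \<open>finite P\<close> by (metis card_Diff_subset card_mono empty_subsetI finite.emptyI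
          finite.insertI insert_subset le_add_diff_inverse2)
    ultimately show ?thesis using \<open>finite P\<close> \<open>p \<noteq> q\<close> by (simp add: Q_def)
  qed
  ultimately show thesis by (rule that)
qed

lemma path_covering_two_switch:
  assumes G: "pair_graph G" and sw: "is_two_switch G a b c d" and P: "path_covering G P"
  obtains Q where "path_covering (two_switch G a b c d) Q" "card Q \<le> card P + 1"
proof -
  note switched = that
  let ?T = "two_switch G a b c d"
  let ?G1 = "delete_edge G a b"
  let ?G2 = "delete_edge ?G1 c d"
  interpret T: pair_graph ?T using G sw by (rule pair_graph_two_switch)
  have T: "sym (parcs ?T)" "finite (pverts ?T)"
    using T.pair_sym_arcs by (simp_all add: symmetric_def)
  have fin: "finite (pverts G)" "finite (pverts ?G1)"
    using T(2) by (simp_all add: two_switch_def)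
  have new: "(a, c) \<in> parcs ?T" "(b, d) \<in> parcs ?T" by (simp_all add: two_switch_def)
  \<comment> \<open>With both old edges gone, what remains is a spanning subgraph of the switched
    graph.\<close>
  have lift: "path_covering ?T Q" if "path_covering ?G2 Q" for Q
    using that by (rule path_covering_mono) (auto simp: two_switch_def)
  from fin(1) P show thesis
  proof (cases rule: path_covering_delete_edge_cases[where u = a and v = b])
    case unused
    from fin(2) unused show thesis
    proof (cases rule: path_covering_delete_edge_cases[where u = c and v = d])
      case unused
      show thesis using switched[OF lift[OF unused]] by simp
    next
      case (cut p2 P2)
      show thesis using switched[OF lift[OF cut(1)]] cut(2) by simp
    qed
  next
    case (cut p1 P1)
    note cut1 = cut
    from fin(2) cut1(1) show thesis
    proof (cases rule: path_covering_delete_edge_cases[where u = c and v = d])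
      case unused
      show thesis using switched[OF lift[OF unused]] cut1(2) by simp
    next
      case (cut p2 P2)
      note cut2 = cut
      \<comment> \<open>Two cuts give \<open>card P + 2\<close> paths; a single join along a new
        edge brings this down to the required bound.\<close>
      have merge: thesis if join: "p \<in> P2" "q \<in> P2" "p \<noteq> q" "x = hd p \<or> x = last p"
        "y = hd q \<or> y = last q" "(x, y) \<in> parcs ?T" for p q x y
      proof -
        obtain Q where "path_covering ?T Q" "card Q + 1 = card P2"
          by (rule path_covering_join[OF T lift[OF cut2(1)] join])
        with cut1(2) cut2(2) show thesis by (intro switched) auto
      qed
      \<comment> \<open>The ends \<open>a\<close>, \<open>b\<close> come from the first cut and
        survive the second, which creates the ends \<open>c\<close>, \<open>d\<close>.\<close>
      have "\<exists>p\<in>P2. x = hd p \<or> x = last p" if "x \<in> {a, b, c, d}" for x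
        using that cut1(6) cut2(6) unfolding path_ends_def by blast
      then obtain pa pb pc pd where ends:
        "pa \<in> P2" "a = hd pa \<or> a = last pa" "pb \<in> P2" "b = hd pb \<or> b = last pb"
        "pc \<in> P2" "c = hd pc \<or> c = last pc" "pd \<in> P2" "d = hd pd \<or> d = last pd"
        by (metis insertCI)
      have "pa \<noteq> pc \<or> pb \<noteq> pd"
      proof (rule ccontr)
        assume "\<not> ?thesis"
        have "s \<noteq> []" if "s \<in> P2" for s
          using cut2(1) that by (auto simp: path_covering_def vpath_with_proj_iff)
        with ends \<open>\<not> ?thesis\<close> have in_paths: "{a, c} \<subseteq> set pa" "{b, d} \<subseteq> set pb" by auto
        from cut2(7) ends(1,3) obtain ra rb where r: "ra \<in> P1" "set pa \<subseteq> set ra"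
          "rb \<in> P1" "set pb \<subseteq> set rb" by meson
        \<comment> \<open>By disjointness, \<open>p2\<close> is the only path of \<open>P1\<close>
          through \<open>c\<close> and the only one through \<open>d\<close>. Hence the paths of
          \<open>P1\<close> enclosing \<open>pa\<close> and \<open>pb\<close> are both
          \<open>p2\<close>, which would contain \<open>a\<close> and \<open>b\<close> after the
          first cut.\<close>
        have p2: "r = p2" if "r \<in> P1" "x \<in> set r" "x \<in> set p2" for r x
          using cut1(1) that cut2(3) unfolding path_covering_def by blast
        have "ra = p2" using r in_paths cut2(4) by (intro p2[of ra c]) auto
        moreover have "rb = p2" using r in_paths cut2(5) by (intro p2[of rb d]) auto
        ultimately have "{a, b} \<subseteq> set p2" using r in_paths by blast
        with cut1(8) cut2(3) show False by blast
      qed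
      then show thesis
        using merge[OF ends(1,5) _ ends(2,6) new(1)] merge[OF ends(3,7) _ ends(4,8) new(2)] by blast
    qed
  qed
qed

lemma path_covering_number_le:
  assumes "path_covering G P"
  shows "path_covering_number G \<le> card P"
  unfolding path_covering_number_def using assms by (intro Least_le) blast

text \<open>The covering by single vertices shows that some size is admissible, so
  \<open>LEAST\<close> really picks the size of a covering.\<close>

lemma path_covering_number_attained:
  obtains P where "path_covering G P" "card P = path_covering_number G"
proof -
  have "\<exists>P. path_covering G P \<and> card P = path_covering_number G"
    unfolding path_covering_number_def
    by (rule LeastI_ex) (use path_covering_singletons in blast)
  then show thesis using that by blast
qed

lemma path_covering_number_two_switch_le:
  assumes "pair_graph G" and "is_two_switch G a b c d"
  shows "path_covering_number (two_switch G a b c d) \<le> path_covering_number G + 1"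
proof -
  obtain P where P: "path_covering G P" "card P = path_covering_number G"
    by (rule path_covering_number_attained)
  obtain Q where "path_covering (two_switch G a b c d) Q" "card Q \<le> card P + 1"
    using assms P(1) by (rule path_covering_two_switch)
  then show ?thesis using P(2) path_covering_number_le by fastforce
qed

lemma two_switch_inverse:
  assumes "pair_graph G" and "is_two_switch G a b c d"
  shows "is_two_switch (two_switch G a b c d) a c b d"
    and "two_switch (two_switch G a b c d) a c b d = G"
proof -
  interpret pair_graph G by fact
  have s: "(x, y) \<in> parcs G \<longleftrightarrow> (y, x) \<in> parcs G" for x y
    using pair_sym_arcs by (auto simp: symmetric_def dest: symD)
  show "is_two_switch (two_switch G a b c d) a c b d"
    using assms(2) by (auto simp: is_two_switch_def two_switch_def)
  \<comment> \<open>Switching back restores the exact arc set because all four removed arcs were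
    present and all four added arcs were absent; symmetry supplies the reversed arcs.\<close>
  have "(a, b) \<in> parcs G" "(b, a) \<in> parcs G" "(c, d) \<in> parcs G" "(d, c) \<in> parcs G"
    "(a, c) \<notin> parcs G" "(c, a) \<notin> parcs G" "(b, d) \<notin> parcs G" "(d, b) \<notin> parcs G"
    using assms(2) s by (auto simp: is_two_switch_def)
  then have "parcs (two_switch (two_switch G a b c d) a c b d) = parcs G"
    by (auto simp: two_switch_def)
  then show "two_switch (two_switch G a b c d) a c b d = G"
    by (simp add: two_switch_def)
qed

theorem mainTheorem15:
  fixes G :: "'a pair_pre_digraph" and a b c d :: 'a
  assumes "pair_graph G"
    and "is_two_switch G a b c d"
  shows "\<bar>int (path_covering_number (two_switch G a b c d)) - int (path_covering_number G)\<bar> \<le> 1"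
proof -
  have "path_covering_number (two_switch G a b c d) \<le> path_covering_number G + 1"
    using assms by (rule path_covering_number_two_switch_le)
  \<comment> \<open>The one-sided bound is applied to the switched graph, with \<open>b\<close> and
    \<open>c\<close> exchanged in the switch.\<close>
  moreover have "path_covering_number G \<le> path_covering_number (two_switch G a b c d) + 1"
    using path_covering_number_two_switch_le[OF pair_graph_two_switch[OF assms]
        two_switch_inverse(1)[OF assms]] two_switch_inverse(2)[OF assms] by simp
  ultimately show ?thesis by linarith
qed

end
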